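(* Let $P$ be a polynomial of degree $d\ge 2$ over $\mathbb{C}$ and suppose that $z\in\mathbb{C}$ is not a critical point of $P$. Then there exists a critical point $\zeta$ of $P$ such that $$ \frac{|P'(z)|}{d\,4^d}\le \left|\frac{P(\zeta)-P(z)}{\zeta-z}\right|. $$
   Context: A point $\zeta\in\mathbb{C}$ is called a critical point of a complex polynomial $P$ if $P'(\zeta)=0$. *)

theory Defs
  imports Complex_Main "HOL-Computational_Algebra.Polynomial"
begin

definition critical_point :: "complex poly \<Rightarrow> complex \<Rightarrow> bool" where
  "critical_point P \<zeta> \<longleftrightarrow> poly (pderiv P) \<zeta> = 0"

end

theory Submission
  imports Defs "HOL-Complex_Analysis.Complex_Analysis"
    "HOL-Computational_Algebra.Fundamental_Theorem_Algebra"
begin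

text \<open>
  Put \<open>Q = P - P(z)\<close>, let \<open>M\<close> be the largest value of \<open>|Q|\<close> at a critical point, and let \<open>\<zeta>\<close> be a
  critical point at maximal distance \<open>L\<close> from \<open>z\<close>. By a mountain pass argument, \<open>z\<close> and \<open>\<zeta>\<close> lie in
  the same component of \<open>{|Q| < r}\<close> for every \<open>r > M\<close>. Projecting that component orthogonally to the
  line through \<open>z\<close> and \<open>\<zeta>\<close> covers a segment of length \<open>L\<close>, and replacing the roots of \<open>Q\<close> by their
  projections only decreases \<open>|Q|\<close>. Hence a polynomial of degree \<open>d\<close> with the leading coefficient
  \<open>a\<close> of \<open>P\<close> is bounded by \<open>M\<close> on a segment of length \<open>L\<close>, so \<open>|a| (L/4)^d \<le> M\<close>. On the other hand
  \<open>|P'(z)| \<le> d |a| L^(d-1)\<close>, because all roots of \<open>P'\<close> are within \<open>L\<close> of \<open>z\<close>. So the critical point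
  where \<open>|Q| = M\<close> has the required property.
\<close>

section \<open>A Chebyshev-type lower bound for monic real-rooted polynomials on a segment\<close>

lemma prod_abs_diff_lower_bound:
  fixes a :: "nat \<Rightarrow> real"
  assumes bound: "\<And>x. 0 \<le> x \<Longrightarrow> x \<le> L \<Longrightarrow> (\<Prod>i<n. \<bar>x - a i\<bar>) \<le> B"
    and "0 \<le> L"
  shows "(L / 4) ^ n \<le> B"
proof -
  \<comment> \<open>On the unit circle \<open>f u = u^n p(x)\<close>, where \<open>p\<close> is the product of the \<open>x - a i\<close> and
    \<open>x = L (2 + u + 1/u) / 4\<close> runs through \<open>[0, L]\<close>.\<close>
  define f :: "complex \<Rightarrow> complex"
    where "f u = (\<Prod>i<n. of_real (L / 4) * (u + 1)\<^sup>2 - u * of_real (a i))" for u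
  \<comment> \<open>At \<open>u = 0\<close> every factor equals \<open>L / 4\<close>, so the maximum
    modulus principle carries the bound on the circle over to \<open>(L / 4) ^ n\<close>.\<close>
  have "norm (f 0) \<le> B"
  proof (rule maximum_modulus_frontier[where S = "ball 0 1" and f = f])
    show "f holomorphic_on interior (ball 0 1)" "continuous_on (closure (ball 0 1)) f"
      unfolding f_def by (intro holomorphic_intros continuous_intros)+
    fix u :: complex
    assume "u \<in> frontier (ball 0 1)"
    then have u: "norm u = 1" by simp
    define x where "x = L * (1 + Re u) / 2"
    have Re_u: "\<bar>Re u\<bar> \<le> 1" using abs_Re_le_cmod[of u] u by simp
    have x: "0 \<le> x" "x \<le> L"
      using Re_u \<open>0 \<le> L\<close> mult_left_mono[of "1 + Re u" 2 L] by (auto simp: x_def abs_le_iff)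
    have "u * (u + cnj u) = u\<^sup>2 + 1"
      using complex_norm_square[of u] u by (simp add: algebra_simps power2_eq_square)
    then have "(u + 1)\<^sup>2 = u * of_real (2 * (1 + Re u))"
      by (simp add: complex_add_cnj power2_eq_square algebra_simps)
    then have "of_real (L / 4) * (u + 1)\<^sup>2 - u * of_real (a i) = u * of_real (x - a i)" for i
      by (simp add: x_def field_simps)
    then have "norm (f u) = (\<Prod>i<n. \<bar>x - a i\<bar>)"
      by (simp add: f_def norm_mult u flip: prod_norm of_real_diff)
    also have "\<dots> \<le> B" using bound x by blast
    finally show "norm (f u) \<le> B" .
  qed auto
  then show ?thesis
    using \<open>0 \<le> L\<close> by (simp add: f_def norm_power norm_divide)
qed

section \<open>Connectedness of sublevel sets: the mountain pass argument\<close>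

text \<open>Since \<open>f\<close> is locally invertible at \<open>p\<close>, the sublevel set near
  \<open>p\<close> is the image under the local inverse of the intersection of two discs, which is
  convex.\<close>

lemma sublevel_locally_connected_at_boundary:
  fixes f :: "complex \<Rightarrow> complex"
  assumes holo: "f holomorphic_on U" and "open U" "p \<in> U"
    and "deriv f p \<noteq> 0" "norm (f p) = c" "0 < c"
  obtains N where "open N" "p \<in> N" "N \<subseteq> U" "connected (N \<inter> {z. norm (f z) < c})"
    "N \<inter> {z. norm (f z) < c} \<noteq> {}"
proof -
  obtain r where r: "r > 0" "ball p r \<subseteq> U" "open (f ` ball p r)" "inj_on f (ball p r)"
    using has_complex_derivative_locally_invertible[OF holo \<open>p \<in> U\<close> \<open>open U\<close> \<open>deriv f p \<noteq> 0\<close>] .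
  have holo': "f holomorphic_on ball p r"
    using holo r(2) holomorphic_on_subset by blast
  obtain g where g: "g holomorphic_on f ` ball p r" "\<And>z. z \<in> ball p r \<Longrightarrow> g (f z) = z"
    using holomorphic_has_inverse[OF holo' open_ball r(4)] by metis
  obtain e where e: "e > 0" "ball (f p) e \<subseteq> f ` ball p r"
    using r(1,3) by (meson centre_in_ball imageI open_contains_ball)
  define N where "N = ball p r \<inter> f -` ball (f p) e"
  define D where "D = ball (f p) e \<inter> ball 0 c"
  have D: "D \<subseteq> f ` ball p r" using e(2) by (auto simp: D_def)
  have "N \<inter> {z. norm (f z) < c} = g ` D"
  proof (intro equalityI subsetI)
    fix z assume "z \<in> N \<inter> {z. norm (f z) < c}"
    then have "f z \<in> D" "g (f z) = z" by (auto simp: N_def D_def g)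
    then show "z \<in> g ` D" by (metis imageI)
  next
    fix z assume "z \<in> g ` D"
    then obtain y where y: "y \<in> D" "z = g y" by blast
    with D obtain x where "x \<in> ball p r" "y = f x" by blast
    then show "z \<in> N \<inter> {z. norm (f z) < c}"
      using y g(2) by (auto simp: N_def D_def)
  qed
  moreover have "connected (g ` D)"
  proof (rule connected_continuous_image)
    show "continuous_on D g"
      using g(1) D holomorphic_on_imp_continuous_on continuous_on_subset by blast
    show "connected D" by (simp add: D_def convex_Int convex_connected)
  qed
  moreover have "D \<noteq> {}"
  proof -
    \<comment> \<open>Shrinking \<open>f p\<close> by the factor \<open>1 - t\<close> enters the
      disc of radius \<open>c\<close> and moves the point by only \<open>t * c < e\<close>.\<close>
    define t where "t = min (1/2) (e / (2 * c))"
    have t: "0 < t" "t < 1" "t * c < e"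
      using \<open>0 < c\<close> e(1) by (auto simp: t_def min_def field_simps)
    have "f p - of_real (1 - t) * f p = of_real t * f p"
      by (simp add: algebra_simps)
    then have "dist (f p) (of_real (1 - t) * f p) = t * c"
      using t(1) assms(5) by (simp add: dist_norm norm_mult)
    moreover have "norm (of_real (1 - t) * f p) < c"
      using t assms(5) \<open>0 < c\<close> by (simp add: norm_mult del: of_real_diff)
    ultimately have "of_real (1 - t) * f p \<in> D"
      using t by (simp add: D_def)
    then show ?thesis by blast
  qed
  moreover have "open N"
    unfolding N_def
    using holo' by (intro continuous_open_preimage holomorphic_on_imp_continuous_on) auto
  moreover have "p \<in> N" "N \<subseteq> U" using r e(1) by (auto simp: N_def)
  ultimately show ?thesis using that by simp
qed

lemma compact_poly_sublevel:
  fixes p :: "complex poly"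
  assumes "degree p > 0"
  shows "compact {z. norm (poly p z) \<le> c}"
proof -
  have "filterlim (poly p) at_infinity at_infinity"
    using assms by (intro filterlim_poly_at_infinity filterlim_ident) auto
  then have "filterlim (\<lambda>z. norm (poly p z)) at_top at_infinity"
    by (rule filterlim_at_infinity_imp_norm_at_top)
  then have "eventually (\<lambda>z. norm (poly p z) > c) at_infinity"
    by (simp add: filterlim_at_top_dense)
  then obtain b where "\<And>z. norm z \<ge> b \<Longrightarrow> norm (poly p z) > c"
    by (auto simp: eventually_at_infinity)
  then have "bounded {z. norm (poly p z) \<le> c}"
    unfolding bounded_iff by (intro exI[of _ b]) (metis linear mem_Collect_eq not_le)
  moreover have "closed {z. norm (poly p z) \<le> c}"
    by (intro closed_Collect_le continuous_intros)
  ultimately show ?thesis by (simp add: compact_eq_bounded_closed)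
qed

text \<open>If \<open>a\<close> and \<open>b\<close> lay in different components at the noncritical
  level \<open>c\<close>, disjoint open sets would still separate them at some level slightly above
  \<open>c\<close>, against \<open>limit\<close>.\<close>

lemma poly_sublevel_connected_component_limit:
  fixes p :: "complex poly"
  assumes "degree p > 0" "c > 0"
    and ncrit: "\<And>w. norm (poly p w) = c \<Longrightarrow> poly (pderiv p) w \<noteq> 0"
    and ab: "norm (poly p a) < c" "norm (poly p b) < c"
    and limit: "\<And>s. s > c \<Longrightarrow> \<exists>t<s. connected_component {w. norm (poly p w) < t} a b"
  shows "connected_component {w. norm (poly p w) < c} a b"
proof (rule ccontr)
  define E where "E = {w. norm (poly p w) < c}"
  define U where "U = connected_component_set E a"
  \<comment> \<open>All other components are lumped together in \<open>V\<close>, so their number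
    does not matter. \<open>V\<close> is open because a component is closed relative to
    \<open>E\<close>.\<close>
  define V where "V = E - U"
  assume "\<not> connected_component {w. norm (poly p w) < c} a b"
  then have b: "b \<in> V" using ab by (auto simp: U_def V_def E_def)
  have a: "a \<in> U" using ab by (auto simp: U_def E_def connected_component_refl)
  have "open E" unfolding E_def by (intro open_Collect_less continuous_intros)
  then have "open U" by (simp add: U_def open_connected_component)
  have UE: "U \<subseteq> E" by (simp add: U_def connected_component_subset)
  have "openin (top_of_set E) V"
    unfolding V_def U_def by (intro openin_diff closedin_connected_component) simp
  then have "open V" using \<open>open E\<close> by (rule openin_open_trans)
  have holo: "poly p holomorphic_on W" for W by (intro holomorphic_intros)
  have nbhd: "\<exists>N. open N \<and> w \<in> N \<and> N \<subseteq> W \<and> connected (N \<inter> E) \<and> N \<inter> E \<noteq> {}"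
    if w: "norm (poly p w) = c" "open W" "w \<in> W" for w W
  proof -
    have "deriv (poly p) w \<noteq> 0"
      using ncrit[OF w(1)] DERIV_imp_deriv[OF poly_DERIV] by metis
    then obtain N where "open N" "w \<in> N" "N \<subseteq> W" "connected (N \<inter> E)" "N \<inter> E \<noteq> {}"
      unfolding E_def
      using sublevel_locally_connected_at_boundary[OF holo w(2,3) _ w(1) \<open>c > 0\<close>] by metis
    then show ?thesis by (intro exI[of _ N] conjI)
  qed
  have closure_E: "{w. norm (poly p w) \<le> c} \<subseteq> closure E"
  proof
    fix w assume "w \<in> {w. norm (poly p w) \<le> c}"
    then consider "w \<in> E" | "norm (poly p w) = c" by (auto simp: E_def le_less)
    then show "w \<in> closure E"
    proof cases
      case 2
      show ?thesis unfolding closure_iff_nhds_not_empty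
        using nbhd[OF 2] by blast
    qed (use closure_subset in blast)
  qed
  have closure_le: "closure W \<subseteq> {w. norm (poly p w) \<le> c}" if "W \<subseteq> E" for W
    using that by (intro closure_minimal closed_Collect_le continuous_intros) (auto simp: E_def)
  \<comment> \<open>Two components can only touch at a critical point: near any other boundary point the sublevel
    set looks like the intersection of two discs.\<close>
  have disj: "closure U \<inter> closure V = {}"
  proof (rule ccontr)
    assume "closure U \<inter> closure V \<noteq> {}"
    then obtain w where w: "w \<in> closure U" "w \<in> closure V" by blast
    have "U \<inter> V = {}" by (auto simp: V_def)
    then have "w \<notin> U" "w \<notin> V"
      using w \<open>open U\<close> \<open>open V\<close> open_Int_closure_eq_empty[of U V] open_Int_closure_eq_empty[of V U]
      by auto
    then have "w \<notin> E" by (auto simp: V_def)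
    then have "norm (poly p w) = c" using closure_le[OF UE] w(1) by (auto simp: E_def le_less)
    then obtain N where N: "open N" "w \<in> N" "connected (N \<inter> E)"
      using nbhd[of w UNIV] by auto
    have "N \<inter> U \<noteq> {}" "N \<inter> V \<noteq> {}"
      using w N(1,2) open_Int_closure_eq_empty[OF N(1)] by blast+
    then show False
      using connectedD[OF N(3) \<open>open U\<close> \<open>open V\<close>] UE \<open>U \<inter> V = {}\<close> by (auto simp: V_def)
  qed
  have "compact (closure U)"
    using closure_le[OF UE] compact_poly_sublevel[OF \<open>degree p > 0\<close>, of c]
    by (meson bounded_subset closed_closure compact_eq_bounded_closed)
  from separation_normal_compact[OF this closed_closure disj]
  obtain U' V' where UV': "open U'" "open V'" "closure U \<subseteq> U'" "closure V \<subseteq> V'" "U' \<inter> V' = {}"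
    by metis
  \<comment> \<open>\<open>K\<close> collects the points up to level \<open>c + 1\<close> that
    escape both open sets. It is compact and \<open>norm (poly p w) > c\<close> on it, so the
    minimum there is a level \<open>s > c\<close> below which nothing escapes.\<close>
  define K where "K = {w. norm (poly p w) \<le> c + 1} - (U' \<union> V')"
  have "E = U \<union> V" using UE by (auto simp: V_def)
  have gt: "norm (poly p w) > c" if "w \<in> K" for w
  proof (rule ccontr)
    assume "\<not> norm (poly p w) > c"
    then have "w \<in> closure E" by (intro subsetD[OF closure_E]) simp
    then have "w \<in> closure U \<union> closure V" by (simp add: \<open>E = U \<union> V\<close>)
    then show False using that UV'(3,4) by (auto simp: K_def)
  qed
  have "compact K" unfolding K_def
    using compact_poly_sublevel[OF \<open>degree p > 0\<close>] UV'(1,2) by (intro compact_diff) auto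
  have "\<exists>s>c. {w. norm (poly p w) < s} \<subseteq> U' \<union> V'"
  proof (cases "K = {}")
    case True
    then show ?thesis by (intro exI[of _ "c + 1"]) (force simp: K_def)
  next
    case False
    obtain w where w: "w \<in> K" "\<And>y. y \<in> K \<Longrightarrow> norm (poly p w) \<le> norm (poly p y)"
      using continuous_attains_inf[OF \<open>compact K\<close> False, of "\<lambda>w. norm (poly p w)"]
      by (auto simp: continuous_on_norm continuous_on_poly)
    have "{y. norm (poly p y) < norm (poly p w)} \<subseteq> U' \<union> V'"
    proof (rule subsetI, rule ccontr)
      fix y assume y: "y \<in> {y. norm (poly p y) < norm (poly p w)}" "y \<notin> U' \<union> V'"
      moreover have "norm (poly p w) \<le> c + 1" using w(1) by (simp add: K_def)
      ultimately have "y \<in> K" by (simp add: K_def)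
      then show False using w(2)[of y] y(1) by simp
    qed
    then show ?thesis using gt[OF w(1)] by blast
  qed
  then obtain s where s: "s > c" "{w. norm (poly p w) < s} \<subseteq> U' \<union> V'" by blast
  obtain t where t: "t < s" "connected_component {w. norm (poly p w) < t} a b"
    using limit[OF s(1)] by blast
  then obtain T where T: "connected T" "T \<subseteq> {w. norm (poly p w) < t}" "a \<in> T" "b \<in> T"
    by (auto simp: connected_component_def)
  have "a \<in> U'" "b \<in> V'" using a b UV' closure_subset by blast+
  moreover have "T \<subseteq> U' \<union> V'" using T(2) s(2) t(1) by force
  ultimately show False
    using connectedD[OF T(1) UV'(1,2)] T(3,4) UV'(5) by blast
qed

text \<open>Take the infimum \<open>c\<close> of the levels joining \<open>a\<close> to
  \<open>b\<close>. It is noncritical, so it joins them too; but then a path has its maximum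
  strictly below \<open>c\<close>, and the level could be lowered unless
  \<open>c = r\<close>.\<close>

lemma poly_sublevel_connected:
  fixes p :: "complex poly"
  assumes "degree p > 0" "r > 0"
    and crit: "\<And>w. poly (pderiv p) w = 0 \<Longrightarrow> norm (poly p w) < r"
    and ab: "norm (poly p a) < r" "norm (poly p b) < r"
  shows "connected_component {w. norm (poly p w) < r} a b"
proof -
  define E where "E s = {w. norm (poly p w) < s}" for s
  \<comment> \<open>The restriction to levels at least \<open>r\<close> keeps the infimum above the
    modulus of every critical value.\<close>
  define S where "S = {s. r \<le> s \<and> connected_component (E s) a b}"
  have attain: "\<exists>w\<in>T. \<forall>y\<in>T. norm (poly p y) \<le> norm (poly p w)"
    if "compact T" "T \<noteq> {}" for T
    using continuous_attains_sup[OF that, of "\<lambda>w. norm (poly p w)"]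
    by (simp add: continuous_on_norm continuous_on_poly)
  have ne: "S \<noteq> {}"
  proof -
    obtain w where w: "\<And>y. y \<in> closed_segment a b \<Longrightarrow> norm (poly p y) \<le> norm (poly p w)"
      using attain[of "closed_segment a b"] by auto
    have "closed_segment a b \<subseteq> E (r + norm (poly p w))"
      using w \<open>r > 0\<close> by (force simp: E_def)
    then have "connected_component (E (r + norm (poly p w))) a b"
      unfolding connected_component_def by (metis connected_segment ends_in_segment)
    then have "r + norm (poly p w) \<in> S" by (simp add: S_def)
    then show ?thesis by blast
  qed
  have bdd: "bdd_below S" unfolding S_def by (intro bdd_belowI[of _ r]) auto
  define c where "c = Inf S"
  have "r \<le> c" unfolding c_def using ne by (intro cInf_greatest) (auto simp: S_def)
  have comp: "connected_component (E c) a b"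
    unfolding E_def
  proof (rule poly_sublevel_connected_component_limit)
    show "poly (pderiv p) w \<noteq> 0" if "norm (poly p w) = c" for w
      using crit[of w] \<open>r \<le> c\<close> that by auto
    show "\<exists>t<s. connected_component {w. norm (poly p w) < t} a b" if "s > c" for s
      using cInf_lessD[OF ne, of s] that by (auto simp: c_def S_def E_def)
  qed (use assms \<open>r \<le> c\<close> in auto)
  have "open (E c)" unfolding E_def by (intro open_Collect_less continuous_intros)
  \<comment> \<open>A path is needed rather than just a connected set: its image is compact, so the
    modulus attains a maximum on it.\<close>
  then have "path_component (E c) a b"
    using comp by (simp add: open_path_connected_component)
  then obtain g where g: "path g" "path_image g \<subseteq> E c" "pathstart g = a" "pathfinish g = b"
    by (auto simp: path_component_def path_defs)
  obtain w where w: "w \<in> path_image g"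
    "\<And>y. y \<in> path_image g \<Longrightarrow> norm (poly p y) \<le> norm (poly p w)"
    using attain[of "path_image g"] g(1) by (auto simp: compact_path_image)
  have wc: "norm (poly p w) < c" using w(1) g(2) by (auto simp: E_def)
  have "c \<le> r"
  proof (rule ccontr)
    assume "\<not> c \<le> r"
    define s where "s = max r ((norm (poly p w) + c) / 2)"
    have s: "norm (poly p w) < s" "s < c" "r \<le> s" using wc \<open>\<not> c \<le> r\<close> by (auto simp: s_def max_def)
    have "path_image g \<subseteq> E s" using w(2) s(1) by (force simp: E_def)
    then have "connected_component (E s) a b"
      unfolding connected_component_def
      using g by (metis connected_path_image pathfinish_in_path_image pathstart_in_path_image)
    then have "s \<in> S" using s(3) by (simp add: S_def)
    then have "c \<le> s" unfolding c_def using bdd by (rule cInf_lower)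
    then show False using s(2) by simp
  qed
  then show ?thesis using comp \<open>r \<le> c\<close> by (simp add: E_def)
qed

section \<open>Estimates from the factorization into linear factors\<close>

lemma norm_poly_le_of_roots_near:
  fixes p :: "complex poly"
  assumes "p \<noteq> 0" and "\<And>w. poly p w = 0 \<Longrightarrow> norm (z - w) \<le> L"
  shows "norm (poly p z) \<le> norm (lead_coeff p) * L ^ degree p"
proof -
  obtain root where root: "smult (lead_coeff p) (\<Prod>i<degree p. [:-root i, 1:]) = p"
    by (rule complex_poly_decompose')
  have eval: "poly p w = lead_coeff p * (\<Prod>i<degree p. w - root i)" for w
    by (subst root[symmetric]) (simp add: poly_prod)
  have "norm (z - root i) \<le> L" if "i < degree p" for i
    using that by (intro assms(2)) (auto simp: eval)
  then have "(\<Prod>i<degree p. norm (z - root i)) \<le> (\<Prod>i<degree p. L)"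
    by (intro prod_mono) auto
  then show ?thesis
    by (simp add: eval norm_mult flip: prod_norm) (simp add: mult_left_mono)
qed

lemma lead_coeff_le_of_critical_values_le:
  fixes p :: "complex poly"
  assumes "degree p > 0"
    and crit: "\<And>w. poly (pderiv p) w = 0 \<Longrightarrow> norm (poly p w) \<le> M"
    and ab: "norm (poly p a) \<le> M" "norm (poly p b) \<le> M"
  shows "norm (lead_coeff p) * (norm (b - a) / 4) ^ degree p \<le> M"
proof (cases "a = b")
  \<comment> \<open>Here the left side is a positive power of 0, and \<open>M\<close> is
    nonnegative.\<close>
  case True
  then show ?thesis using assms(1) ab(1) norm_ge_zero[of "poly p a"]
    by (auto simp: power_0_left intro: order_trans[OF norm_ge_zero])
next
  case False
  define L where "L = norm (b - a)"
  have L: "L > 0" using False by (simp add: L_def)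
  \<comment> \<open>Multiplication by \<open>v\<close> turns the direction \<open>b - a\<close> into
    the positive real axis, so \<open>\<pi>\<close> below is the coordinate of the orthogonal
    projection, with \<open>a\<close> at 0 and \<open>b\<close> at \<open>L\<close>.\<close>
  define v where "v = cnj ((b - a) / of_real L)"
  have v: "norm v = 1" using L by (simp add: v_def norm_divide L_def del: complex_cnj_divide complex_cnj_diff)
  define \<pi> where "\<pi> w = Re ((w - a) * v)" for w
  have \<pi>a: "\<pi> a = 0" by (simp add: \<pi>_def)
  have "(b - a) * v = of_real L"
  proof -
    have "(b - a) * cnj (b - a) = of_real (L ^ 2)"
      by (metis L_def complex_norm_square of_real_power)
    then show ?thesis using L by (simp add: v_def field_simps power2_eq_square)
  qed
  then have \<pi>b: "\<pi> b = L" by (simp add: \<pi>_def)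
  have \<pi>_le: "\<bar>\<pi> x - \<pi> y\<bar> \<le> norm (x - y)" for x y
  proof -
    have "\<pi> x - \<pi> y = Re ((x - y) * v)" by (simp add: \<pi>_def algebra_simps)
    also have "\<bar>\<dots>\<bar> \<le> norm ((x - y) * v)" by (rule abs_Re_le_cmod)
    finally show ?thesis by (simp add: norm_mult v)
  qed
  obtain root where root: "smult (lead_coeff p) (\<Prod>i<degree p. [:-root i, 1:]) = p"
    by (rule complex_poly_decompose')
  have eval: "poly p w = lead_coeff p * (\<Prod>i<degree p. w - root i)" for w
    by (subst root[symmetric]) (simp add: poly_prod)
  have lc: "norm (lead_coeff p) > 0" using assms(1) by auto
  have "(L / 4) ^ degree p \<le> M / norm (lead_coeff p)"
  proof (rule prod_abs_diff_lower_bound)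
    fix x assume x: "0 \<le> x" "x \<le> L"
    have "norm (lead_coeff p) * (\<Prod>i<degree p. \<bar>x - \<pi> (root i)\<bar>) \<le> M"
    \<comment> \<open>The slack \<open>e\<close> makes the bounds by \<open>M\<close> strict, as the
      connectedness lemma requires.\<close>
    proof (rule field_le_epsilon)
      fix e :: real assume "e > 0"
      have "M \<ge> 0" using ab(1) norm_ge_zero order_trans by blast
      have "connected_component {w. norm (poly p w) < M + e} a b"
        using assms \<open>e > 0\<close> \<open>M \<ge> 0\<close>
        by (intro poly_sublevel_connected) (auto intro: le_less_trans[of _ M])
      then obtain T where T: "connected T" "T \<subseteq> {w. norm (poly p w) < M + e}" "a \<in> T" "b \<in> T"
        by (auto simp: connected_component_def)
      have "connected (\<pi> ` T)"
        unfolding \<pi>_def using T(1) by (intro connected_continuous_image continuous_intros)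
      \<comment> \<open>A connected set of reals containing 0 and \<open>L\<close> contains
        everything between them.\<close>
      then have "x \<in> \<pi> ` T"
        using connectedD_interval[of "\<pi> ` T" 0 L x] x T(3,4) \<pi>a \<pi>b by (metis imageI)
      then obtain w where w: "w \<in> T" "x = \<pi> w" by blast
      have "norm (lead_coeff p) * (\<Prod>i<degree p. \<bar>x - \<pi> (root i)\<bar>)
            \<le> norm (lead_coeff p) * (\<Prod>i<degree p. norm (w - root i))"
        using w(2) \<pi>_le by (intro mult_left_mono prod_mono) auto
      also have "\<dots> = norm (poly p w)" by (simp add: eval norm_mult prod_norm)
      also have "\<dots> \<le> M + e" using w(1) T(2) by force
      finally show "norm (lead_coeff p) * (\<Prod>i<degree p. \<bar>x - \<pi> (root i)\<bar>) \<le> M + e" .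
    qed
    then show "(\<Prod>i<degree p. \<bar>x - \<pi> (root i)\<bar>) \<le> M / norm (lead_coeff p)"
      using lc by (simp add: field_simps)
  qed (use L in simp)
  then show ?thesis using lc by (simp add: L_def pos_le_divide_eq mult.commute)
qed

section \<open>Combining the estimates at two extremal critical points\<close>

theorem theorem1:
  fixes P :: "complex poly" and d :: nat and z :: complex
  assumes "degree P = d" and "d \<ge> 2" and "\<not> critical_point P z"
  shows "\<exists>\<zeta>. critical_point P \<zeta> \<and>
    cmod (poly (pderiv P) z) / (real d * 4 ^ d) \<le> cmod ((poly P \<zeta> - poly P z) / (\<zeta> - z))"
proof -
  \<comment> \<open>The shift makes \<open>z\<close> a root, so the bound by \<open>M\<close>
    required at the endpoint \<open>z\<close> is automatic.\<close>
  define Q where "Q = P - [:poly P z:]"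
  define C where "C = {w. poly (pderiv P) w = 0}"
  have Q: "poly Q w = poly P w - poly P z" "pderiv Q = pderiv P" for w
    by (simp_all add: Q_def pderiv_diff)
  have coeff_Q: "coeff Q d = coeff P d" using assms(2) by (cases d) (auto simp: Q_def)
  have "degree Q \<le> d" unfolding Q_def using assms(1) by (intro degree_diff_le) auto
  moreover have lc0: "coeff P d \<noteq> 0" using assms(1,2) by auto
  ultimately have deg_Q: "degree Q = d" using coeff_Q le_degree[of Q d] by simp
  have deg': "degree (pderiv P) = d - 1" by (simp add: degree_pderiv assms(1))
  have lead': "coeff (pderiv P) (d - 1) = of_nat d * coeff P d"
    using assms(2) by (simp add: coeff_pderiv Suc_diff_1 flip: of_nat_Suc)
  have "pderiv P \<noteq> 0" using assms(3) by (auto simp: critical_point_def)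
  then have "finite C" unfolding C_def by (rule poly_roots_finite)
  have "\<exists>w. poly (pderiv P) w = 0"
    using deg' assms(2)
    by (intro fundamental_theorem_of_algebra) (auto simp: constant_degree)
  then have "C \<noteq> {}" by (auto simp: C_def)
  have attain: "\<exists>x\<in>C. \<forall>w\<in>C. g w \<le> g x" for g :: "complex \<Rightarrow> real"
    using obtains_MAX[OF \<open>finite C\<close> \<open>C \<noteq> {}\<close>, of g] \<open>finite C\<close>
    by (metis Max_ge finite_imageI imageI)
  \<comment> \<open>The two extremal points may differ: the farthest point \<open>\<eta>\<close>
    only supplies the length \<open>L\<close>, while the witness is \<open>\<zeta>\<close>, where
    the modulus of \<open>Q\<close> is largest.\<close>
  obtain \<eta> where \<eta>: "\<eta> \<in> C" "\<And>w. w \<in> C \<Longrightarrow> norm (w - z) \<le> norm (\<eta> - z)"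
    using attain[of "\<lambda>w. norm (w - z)"] by blast
  obtain \<zeta> where \<zeta>: "\<zeta> \<in> C" "\<And>w. w \<in> C \<Longrightarrow> norm (poly Q w) \<le> norm (poly Q \<zeta>)"
    using attain[of "\<lambda>w. norm (poly Q w)"] by blast
  define L where "L = norm (\<eta> - z)"
  define M where "M = norm (poly Q \<zeta>)"
  have "norm (lead_coeff Q) * (norm (\<eta> - z) / 4) ^ degree Q \<le> M"
    using \<zeta> \<eta>(1) assms(2) deg_Q
    by (intro lead_coeff_le_of_critical_values_le) (auto simp: Q M_def C_def)
  then have M: "norm (coeff P d) * L ^ d \<le> M * 4 ^ d"
    by (simp add: deg_Q coeff_Q L_def power_divide field_simps)
  have "norm (poly (pderiv P) z) \<le> norm (lead_coeff (pderiv P)) * L ^ degree (pderiv P)"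
    using \<open>pderiv P \<noteq> 0\<close> \<eta>(2)
    by (intro norm_poly_le_of_roots_near) (auto simp: L_def C_def norm_minus_commute)
  then have D: "norm (poly (pderiv P) z) \<le> real d * norm (coeff P d) * L ^ (d - 1)"
    unfolding deg' lead' by (simp add: norm_mult)
  have pos: "norm (\<zeta> - z) > 0"
    using \<zeta>(1) assms(3) by (auto simp: C_def critical_point_def)
  \<comment> \<open>The distance from \<open>\<zeta>\<close> to \<open>z\<close> is at most
    \<open>L\<close>, which supplies the missing factor to turn \<open>L ^ (d - 1)\<close> into
    \<open>L ^ d\<close>.\<close>
  have "norm (poly (pderiv P) z) * norm (\<zeta> - z) \<le> real d * norm (coeff P d) * L ^ (d - 1) * L"
    using D \<eta>(2)[OF \<zeta>(1)] by (intro mult_mono) (auto simp: L_def)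
  also have "\<dots> = real d * (norm (coeff P d) * L ^ d)"
    using assms(2) by (cases d) auto
  also have "\<dots> \<le> real d * (M * 4 ^ d)" using M by (intro mult_left_mono) auto
  finally have "norm (poly (pderiv P) z) / (real d * 4 ^ d) \<le> M / norm (\<zeta> - z)"
    using pos assms(2) by (simp add: field_simps)
  then show ?thesis
    using \<zeta>(1) by (intro exI[of _ \<zeta>]) (auto simp: C_def critical_point_def M_def Q norm_divide)
qed

end
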